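(* Suppose $v$ is an unlooped vertex of a graph $G$. 1. If $v$ is isolated then $M_A(G)/v = M_A(G-v)$. 2. If $w$ is an unlooped neighbor of $v$ then $M_A(G)/v = M_A((G^{w})^{v}-v)$. 3. If $w$ is a looped neighbor of $v$ then $M_A(G)/v = M_A(((G^{v})^{w})^{v}-v)$.
   Context: Graphs are finite and may have loops and parallel edges. $\mathcal{A}(G)$ is the symmetric $V(G)\times V(G)$ matrix over $GF(2)$ with $a_{vv}=1$ iff $v$ is looped and, for $v\ne w$, $a_{vw}=1$ iff $v,w$ are adjacent. The adjacency matroid $M_A(G)$ is the binary matroid on $V(G)$ whose circuits are the minimal nonempty $S\subseteq V(G)$ such that the columns of $\mathcal{A}(G)$ indexed by $S$ are linearly dependent over $GF(2)$. The local complement $G^{v}$ is the looped simple graph (no parallel edges, at most one loop per vertex) obtained from $G$ by toggling the loop status of every neighbor $w\neq v$ of $v$ and toggling the adjacency status of every pair of distinct neighbors of $v$ (both different from $v$); all other adjacencies and loop statuses, including the loop status of $v$, are unchanged, and parallel edges are replaced by single edges. $G-v$ is the full subgraph induced by $V(G)\setminus\{v\}$. For a matroid $M$ on $V$ and $v\in V$, the contraction $M/v$ is the matroid on $V\setminus\{v\}$ whose circuits are the minimal nonempty subsets $\gamma\subseteq V\setminus\{v\}$ such that $\gamma\cup\{v\}$ contains a circuit of $M$.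
   Formalization: Contraction M/v is taken in its standard form: the circuit contained in γ∪{v} must differ from {v}. Under the literal wording part 1 fails, e.g. for v isolated unlooped and another vertex isolated looped; parts 2 and 3 are unaffected. *)

theory Defs
  imports Main "HOL-Library.Z2"
begin

section \<open>Graphs with loops and parallel edges\<close>

text \<open>
  An edge is an abstract object whose set of ends has one element (a loop) or two elements;
  parallel edges are distinct edges with the same ends.
\<close>

record ('v, 'e) mgraph =
  verts :: "'v set"
  edges :: "'e set"
  ends :: "'e \<Rightarrow> 'v set"

definition fin_graph :: "('v, 'e) mgraph \<Rightarrow> bool" where
  "fin_graph G \<longleftrightarrow> finite (verts G) \<and> finite (edges G) \<and>
     (\<forall>e \<in> edges G. ends G e \<subseteq> verts G \<and> card (ends G e) \<in> {1, 2})"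

definition looped :: "('v, 'e) mgraph \<Rightarrow> 'v \<Rightarrow> bool" where
  "looped G v \<longleftrightarrow> (\<exists>e \<in> edges G. ends G e = {v})"

definition adjacent :: "('v, 'e) mgraph \<Rightarrow> 'v \<Rightarrow> 'v \<Rightarrow> bool" where
  "adjacent G v w \<longleftrightarrow> v \<noteq> w \<and> (\<exists>e \<in> edges G. ends G e = {v, w})"

definition isolated :: "('v, 'e) mgraph \<Rightarrow> 'v \<Rightarrow> bool" where
  "isolated G v \<longleftrightarrow> (\<forall>e \<in> edges G. v \<notin> ends G e)"

definition delete_vertex :: "('v, 'e) mgraph \<Rightarrow> 'v \<Rightarrow> ('v, 'e) mgraph" where
  "delete_vertex G v =
     \<lparr>verts = verts G - {v}, edges = {e \<in> edges G. v \<notin> ends G e}, ends = ends G\<rparr>"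

text \<open>
  A local complement is a looped simple graph, so its edges are taken to be their own sets of
  ends. On propositions, \<open>P \<noteq> Q\<close> is exclusive or: it toggles \<open>P\<close> exactly when \<open>Q\<close> holds.
  Since \<open>adjacent\<close> is irreflexive, the neighbors of \<open>v\<close> below never include \<open>v\<close>.
\<close>

definition local_complement :: "('v, 'e) mgraph \<Rightarrow> 'v \<Rightarrow> ('v, 'v set) mgraph" where
  "local_complement G v =
     \<lparr>verts = verts G,
      edges = {{x} | x. x \<in> verts G \<and> (looped G x \<noteq> adjacent G v x)} \<union>
              {{x, y} | x y. x \<in> verts G \<and> y \<in> verts G \<and> x \<noteq> y \<and>
                 (adjacent G x y \<noteq> (adjacent G v x \<and> adjacent G v y))},
      ends = (\<lambda>e. e)\<rparr>"

lemma adjacent_sym: "adjacent G v w \<longleftrightarrow> adjacent G w v"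
  by (auto simp: adjacent_def insert_commute)

lemma fin_graph_delete_vertex: "fin_graph G \<Longrightarrow> fin_graph (delete_vertex G v)"
  by (auto simp: fin_graph_def delete_vertex_def)

lemma verts_local_complement [simp]: "verts (local_complement G v) = verts G"
  by (simp add: local_complement_def)

lemma fin_graph_local_complement:
  assumes "fin_graph G"
  shows "fin_graph (local_complement G v)"
proof -
  have "edges (local_complement G v) \<subseteq> Pow (verts G)"
    by (auto simp: local_complement_def)
  then have "finite (edges (local_complement G v))"
    using assms finite_subset by (fastforce simp: fin_graph_def)
  then show ?thesis
    using assms by (auto simp: fin_graph_def local_complement_def)
qed

lemma looped_local_complement:
  assumes "x \<in> verts G"
  shows "looped (local_complement G v) x \<longleftrightarrow> (looped G x \<noteq> adjacent G v x)"
proof -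
  have "looped (local_complement G v) x \<longleftrightarrow> {x} \<in> edges (local_complement G v)"
    unfolding looped_def by (simp add: local_complement_def)
  also have "\<dots> \<longleftrightarrow> (looped G x \<noteq> adjacent G v x)"
    using assms by (auto simp: local_complement_def doubleton_eq_iff)
  finally show ?thesis .
qed

lemma adjacent_local_complement:
  assumes "x \<in> verts G" "y \<in> verts G" "x \<noteq> y"
  shows "adjacent (local_complement G v) x y \<longleftrightarrow>
           (adjacent G x y \<noteq> (adjacent G v x \<and> adjacent G v y))"
proof -
  have "adjacent (local_complement G v) x y \<longleftrightarrow> {x, y} \<in> edges (local_complement G v)"
    unfolding adjacent_def using assms(3) by (simp add: local_complement_def)
  also have "\<dots> \<longleftrightarrow> (adjacent G x y \<noteq> (adjacent G v x \<and> adjacent G v y))"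
    using assms adjacent_sym[of G x y]
    by (auto simp: local_complement_def doubleton_eq_iff)
  finally show ?thesis .
qed


section \<open>Matroids given by circuits\<close>

record 'a matroid =
  ground :: "'a set"
  circuits :: "'a set set"

definition is_matroid :: "'a matroid \<Rightarrow> bool" where
  "is_matroid M \<longleftrightarrow> finite (ground M) \<and> circuits M \<subseteq> Pow (ground M) \<and> {} \<notin> circuits M \<and>
     (\<forall>C \<in> circuits M. \<forall>D \<in> circuits M. C \<subseteq> D \<longrightarrow> C = D) \<and>
     (\<forall>C \<in> circuits M. \<forall>D \<in> circuits M. \<forall>e \<in> C \<inter> D.
        C \<noteq> D \<longrightarrow> (\<exists>B \<in> circuits M. B \<subseteq> (C \<union> D) - {e}))"

lemma matroid_antichain:
  "is_matroid M \<Longrightarrow> C \<in> circuits M \<Longrightarrow> D \<in> circuits M \<Longrightarrow> C \<subseteq> D \<Longrightarrow> C = D"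
  unfolding is_matroid_def by simp

lemma matroid_elimination:
  assumes "is_matroid M" "C \<in> circuits M" "D \<in> circuits M" "e \<in> C \<inter> D" "C \<noteq> D"
  obtains B where "B \<in> circuits M" "B \<subseteq> (C \<union> D) - {e}"
proof -
  have "\<forall>C \<in> circuits M. \<forall>D \<in> circuits M. \<forall>e \<in> C \<inter> D.
          C \<noteq> D \<longrightarrow> (\<exists>B \<in> circuits M. B \<subseteq> (C \<union> D) - {e})"
    using assms(1) unfolding is_matroid_def by (elim conjE)
  from this[rule_format, OF assms(2-5)] show ?thesis using that by blast
qed

definition minimal_sets :: "('a set \<Rightarrow> bool) \<Rightarrow> 'a set set" where
  "minimal_sets P = {S. P S \<and> (\<forall>T. T \<subset> S \<longrightarrow> \<not> P T)}"

text \<open>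
  The condition \<open>C \<noteq> {v}\<close> only matters when \<open>v\<close> is a loop of the matroid. Without it, every
  singleton would then be a circuit of the contraction, whereas contracting a loop amounts to
  deleting it. The lemma \<open>circuits_contract_eq\<close> below shows that this is the usual
  contraction.
\<close>

definition contract :: "'a matroid \<Rightarrow> 'a \<Rightarrow> 'a matroid" where
  "contract M v =
     \<lparr>ground = ground M - {v},
      circuits = minimal_sets (\<lambda>S. S \<noteq> {} \<and> S \<subseteq> ground M - {v} \<and>
        (\<exists>C \<in> circuits M. C \<noteq> {v} \<and> C \<subseteq> S \<union> {v}))\<rparr>"

lemma minimal_sets_antichain:
  "C \<in> minimal_sets P \<Longrightarrow> D \<in> minimal_sets P \<Longrightarrow> C \<subseteq> D \<Longrightarrow> C = D"
  unfolding minimal_sets_def by blast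

lemma minimal_sets_subset:
  assumes "finite S" "P S"
  shows "\<exists>T \<subseteq> S. T \<in> minimal_sets P"
  using assms
proof (induction S rule: finite_psubset_induct)
  case (psubset S)
  show ?case
  proof (cases "\<exists>U. U \<subset> S \<and> P U")
    case True
    then obtain U where "U \<subset> S" "P U" by blast
    with psubset.IH obtain T where "T \<subseteq> U" "T \<in> minimal_sets P" by blast
    with \<open>U \<subset> S\<close> show ?thesis by blast
  next
    case False
    with psubset.prems have "S \<in> minimal_sets P" unfolding minimal_sets_def by blast
    then show ?thesis by blast
  qed
qed

lemma circuits_contract_eq:
  assumes "is_matroid M"
  shows "circuits (contract M v) =
           minimal_sets (\<lambda>S. S \<noteq> {} \<and> S \<in> (\<lambda>C. C - {v}) ` circuits M)"
    (is "?L = minimal_sets ?Q")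
proof -
  let ?P = "\<lambda>S. S \<noteq> {} \<and> S \<subseteq> ground M - {v} \<and>
              (\<exists>C \<in> circuits M. C \<noteq> {v} \<and> C \<subseteq> S \<union> {v})"
  have QP: "?P S" if Q: "?Q S" for S
  proof -
    obtain C where C: "C \<in> circuits M" "S = C - {v}" "S \<noteq> {}"
      using Q by blast
    have "C \<subseteq> ground M" using C(1) assms by (auto simp: is_matroid_def)
    then show ?thesis using C by auto
  qed
  have PQ: "\<exists>T \<subseteq> S. ?Q T" if P: "?P S" for S
  proof -
    obtain C where C: "C \<in> circuits M" "C \<noteq> {v}" "C \<subseteq> S \<union> {v}"
      using P by blast
    have "C \<noteq> {}" using C(1) assms by (auto simp: is_matroid_def)
    then have "?Q (C - {v})" using C by auto
    then show ?thesis using C(3) by (intro exI[of _ "C - {v}"]) auto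
  qed
  have "minimal_sets ?P = minimal_sets ?Q"
  proof (intro equalityI subsetI)
    fix S assume "S \<in> minimal_sets ?P"
    then have S: "?P S" "\<And>T. T \<subset> S \<Longrightarrow> \<not> ?P T" unfolding minimal_sets_def by auto
    obtain T where T: "T \<subseteq> S" "?Q T" using PQ[OF S(1)] by blast
    have "T = S" using T S(2)[of T] QP[of T] by (meson psubsetI)
    moreover have "\<not> ?Q U" if "U \<subset> S" for U using S(2)[OF that] QP[of U] by metis
    ultimately show "S \<in> minimal_sets ?Q" using T unfolding minimal_sets_def by blast
  next
    fix S assume "S \<in> minimal_sets ?Q"
    then have S: "?Q S" "\<And>T. T \<subset> S \<Longrightarrow> \<not> ?Q T" unfolding minimal_sets_def by auto
    have "\<not> ?P U" if U: "U \<subset> S" for U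
    proof
      assume "?P U"
      from PQ[OF this] obtain T where T: "T \<subseteq> U" "?Q T" by blast
      from T(1) U have "T \<subset> S" by (rule subset_psubset_trans)
      from S(2)[OF this] T(2) show False by (rule notE)
    qed
    with QP[OF S(1)] show "S \<in> minimal_sets ?P"
      unfolding minimal_sets_def by (intro CollectI conjI allI impI) simp_all
  qed
  then show ?thesis by (simp add: contract_def)
qed

lemma is_matroid_contract:
  assumes "is_matroid M"
  shows "is_matroid (contract M v)"
proof -
  let ?P = "\<lambda>S. S \<noteq> {} \<and> S \<subseteq> ground M - {v} \<and>
              (\<exists>C \<in> circuits M. C \<noteq> {v} \<and> C \<subseteq> S \<union> {v})"
  let ?Q = "\<lambda>S. S \<noteq> {} \<and> S \<in> (\<lambda>C. C - {v}) ` circuits M"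
  have fin: "finite (ground M)" and sub: "circuits M \<subseteq> Pow (ground M)"
    and nonempty: "{} \<notin> circuits M"
    using assms by (simp_all add: is_matroid_def)
  have cP: "circuits (contract M v) = minimal_sets ?P" by (simp add: contract_def)
  have elim: "\<exists>B \<in> minimal_sets ?P. B \<subseteq> (C \<union> D) - {e}"
    if CD: "C \<in> minimal_sets ?P" "D \<in> minimal_sets ?P" "e \<in> C \<inter> D" "C \<noteq> D" for C D e
  proof -
    have "C \<in> minimal_sets ?Q" "D \<in> minimal_sets ?Q"
      using CD circuits_contract_eq[OF assms, of v] cP by simp_all
    then have "?Q C" "?Q D" by (simp_all add: minimal_sets_def)
    then obtain C' D' where C': "C' \<in> circuits M" "C = C' - {v}"
      and D': "D' \<in> circuits M" "D = D' - {v}" by blast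
    have e: "e \<in> C' \<inter> D'" "e \<noteq> v" "C' \<noteq> D'" using CD C' D' by auto
    obtain B where B: "B \<in> circuits M" "B \<subseteq> (C' \<union> D') - {e}"
      using matroid_elimination[OF assms C'(1) D'(1) e(1,3)] by blast
    have "B \<noteq> {v}"
    proof
      assume Bv: "B = {v}"
      then have "B \<subseteq> C' \<or> B \<subseteq> D'" using B by auto
      then have "B = C' \<or> B = D'"
        using matroid_antichain[OF assms B(1)] C'(1) D'(1) by blast
      then have "{v} = C' \<or> {v} = D'" using Bv by simp
      then show False using e by auto
    qed
    moreover have "B \<noteq> {}" "B \<subseteq> ground M" using sub nonempty B(1) by auto
    ultimately have "?P (B - {v})" using B(1) by blast
    moreover have "finite (B - {v})"
      using finite_subset[OF \<open>B \<subseteq> ground M\<close> fin] by simp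
    ultimately have "\<exists>T \<subseteq> B - {v}. T \<in> minimal_sets ?P"
      by (intro minimal_sets_subset)
    moreover have "B - {v} \<subseteq> (C \<union> D) - {e}" using B(2) C' D' by auto
    ultimately show ?thesis by (meson subset_trans)
  qed
  show ?thesis
    unfolding is_matroid_def cP
  proof (intro conjI)
    show "finite (ground (contract M v))" using fin by (simp add: contract_def)
    show "minimal_sets ?P \<subseteq> Pow (ground (contract M v))"
      by (auto simp: contract_def minimal_sets_def)
    show "{} \<notin> minimal_sets ?P" by (simp add: minimal_sets_def)
    show "\<forall>C \<in> minimal_sets ?P. \<forall>D \<in> minimal_sets ?P. C \<subseteq> D \<longrightarrow> C = D"
      by (intro ballI impI) (rule minimal_sets_antichain)
    show "\<forall>C \<in> minimal_sets ?P. \<forall>D \<in> minimal_sets ?P. \<forall>e \<in> C \<inter> D.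
            C \<noteq> D \<longrightarrow> (\<exists>B \<in> minimal_sets ?P. B \<subseteq> (C \<union> D) - {e})"
      by (intro ballI impI) (rule elim)
  qed
qed


section \<open>The adjacency matroid\<close>

definition adj_matrix :: "('v, 'e) mgraph \<Rightarrow> 'v \<Rightarrow> 'v \<Rightarrow> bit" where
  "adj_matrix G v w = of_bool (if v = w then looped G v else adjacent G v w)"

text \<open>
  \<open>A i j\<close> is the entry in row \<open>i\<close> and column \<open>j\<close>. The columns are treated as a family indexed
  by \<open>S\<close>, so two equal columns with different indices are dependent. This is why the predicate
  \<open>dependent\<close> on sets of vectors is not used.
\<close>

definition columns_dependent :: "('r \<Rightarrow> 'c \<Rightarrow> 'k::field) \<Rightarrow> 'r set \<Rightarrow> 'c set \<Rightarrow> bool" where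
  "columns_dependent A R S \<longleftrightarrow>
     (\<exists>c. (\<exists>s \<in> S. c s \<noteq> 0) \<and> (\<forall>r \<in> R. (\<Sum>s \<in> S. c s * A r s) = 0))"

definition adjacency_matroid :: "('v, 'e) mgraph \<Rightarrow> 'v matroid" where
  "adjacency_matroid G =
     \<lparr>ground = verts G,
      circuits = minimal_sets (\<lambda>S. S \<noteq> {} \<and> S \<subseteq> verts G \<and>
        columns_dependent (adj_matrix G) (verts G) S)\<rparr>"

lemma columns_dependent_support:
  assumes "finite S" "\<exists>s \<in> S. c s \<noteq> 0" "\<forall>r \<in> R. (\<Sum>s \<in> S. c s * A r s) = 0"
  shows "columns_dependent A R {s \<in> S. c s \<noteq> 0}"
proof -
  have "(\<Sum>s \<in> {s \<in> S. c s \<noteq> 0}. c s * A r s) = (\<Sum>s \<in> S. c s * A r s)" for r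
    by (rule sum.mono_neutral_left[OF assms(1)]) auto
  then have "\<forall>r \<in> R. (\<Sum>s \<in> {s \<in> S. c s \<noteq> 0}. c s * A r s) = 0"
    using assms(3) by simp
  moreover have "\<exists>s \<in> {s \<in> S. c s \<noteq> 0}. c s \<noteq> 0" using assms(2) by blast
  ultimately show ?thesis unfolding columns_dependent_def by blast
qed

lemma is_matroid_adjacency_matroid:
  assumes "fin_graph G"
  shows "is_matroid (adjacency_matroid G)"
proof -
  let ?V = "verts G" and ?A = "adj_matrix G"
  let ?P = "\<lambda>S. S \<noteq> {} \<and> S \<subseteq> ?V \<and> columns_dependent ?A ?V S"
  have fin: "finite ?V" using assms by (simp add: fin_graph_def)
  have coeffs: "\<exists>c. (\<forall>s \<in> C. c s \<noteq> 0) \<and> (\<forall>s. s \<notin> C \<longrightarrow> c s = 0) \<and>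
      (\<forall>r \<in> ?V. (\<Sum>s \<in> ?V. c s * ?A r s) = 0)"
    if C: "C \<in> minimal_sets ?P" for C
  proof -
    have CV: "C \<subseteq> ?V" using C by (auto simp: minimal_sets_def)
    then have fC: "finite C" using fin by (rule finite_subset)
    obtain c where c: "\<exists>s \<in> C. c s \<noteq> 0" "\<forall>r \<in> ?V. (\<Sum>s \<in> C. c s * ?A r s) = 0"
      using C unfolding minimal_sets_def columns_dependent_def by blast
    have "columns_dependent ?A ?V {s \<in> C. c s \<noteq> 0}"
      by (rule columns_dependent_support[OF fC c])
    then have "?P {s \<in> C. c s \<noteq> 0}" using c(1) CV by blast
    then have "\<not> {s \<in> C. c s \<noteq> 0} \<subset> C" using C unfolding minimal_sets_def by blast
    then have all: "\<forall>s \<in> C. c s \<noteq> 0" by blast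
    let ?c = "\<lambda>s. if s \<in> C then c s else 0"
    have "(\<Sum>s \<in> ?V. ?c s * ?A r s) = (\<Sum>s \<in> C. c s * ?A r s)" for r
      using fin CV by (intro sum.mono_neutral_cong_right) auto
    then show ?thesis using all c(2) by (intro exI[of _ ?c]) simp
  qed
  have elim: "\<exists>B \<in> minimal_sets ?P. B \<subseteq> (C \<union> D) - {e}"
    if CD: "C \<in> minimal_sets ?P" "D \<in> minimal_sets ?P" "e \<in> C \<inter> D" "C \<noteq> D" for C D e
  proof -
    obtain c where c: "\<forall>s \<in> C. c s \<noteq> 0" "\<forall>s. s \<notin> C \<longrightarrow> c s = 0"
      "\<forall>r \<in> ?V. (\<Sum>s \<in> ?V. c s * ?A r s) = 0" using coeffs[OF CD(1)] by blast
    obtain d where d: "\<forall>s \<in> D. d s \<noteq> 0" "\<forall>s. s \<notin> D \<longrightarrow> d s = 0"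
      "\<forall>r \<in> ?V. (\<Sum>s \<in> ?V. d s * ?A r s) = 0" using coeffs[OF CD(2)] by blast
    define b where "b s = d e * c s - c e * d s" for s
    have CV: "C \<subseteq> ?V" using CD(1) by (auto simp: minimal_sets_def)
    have "\<not> C \<subset> D"
      using minimal_sets_antichain[OF CD(1,2)] CD(4) by blast
    then obtain x where x: "x \<in> C" "x \<notin> D" using CD(4) by blast
    have bx: "\<exists>s \<in> ?V. b s \<noteq> 0"
    proof (intro bexI)
      have "d e * c x \<noteq> 0" using c(1) d(1) x CD(3) by auto
      then show "b x \<noteq> 0" using d(2) x by (simp add: b_def)
      show "x \<in> ?V" using x CV by blast
    qed
    have sum0: "\<forall>r \<in> ?V. (\<Sum>s \<in> ?V. b s * ?A r s) = 0"
    proof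
      fix r assume "r \<in> ?V"
      have "(\<Sum>s \<in> ?V. b s * ?A r s) =
              d e * (\<Sum>s \<in> ?V. c s * ?A r s) - c e * (\<Sum>s \<in> ?V. d s * ?A r s)"
        unfolding b_def sum_distrib_left sum_subtractf[symmetric]
        by (intro sum.cong refl) (simp only: left_diff_distrib mult.assoc)
      then show "(\<Sum>s \<in> ?V. b s * ?A r s) = 0" using c(3) d(3) \<open>r \<in> ?V\<close> by simp
    qed
    let ?B = "{s \<in> ?V. b s \<noteq> 0}"
    have "columns_dependent ?A ?V ?B" by (rule columns_dependent_support[OF fin bx sum0])
    then have "?P ?B" using bx by blast
    moreover have "finite ?B" using fin by simp
    ultimately have "\<exists>T \<subseteq> ?B. T \<in> minimal_sets ?P"
      by (intro minimal_sets_subset)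
    moreover have "?B \<subseteq> (C \<union> D) - {e}"
    proof
      fix s assume "s \<in> ?B"
      then have "b s \<noteq> 0" by simp
      moreover have "b e = 0" unfolding b_def by (simp only: mult.commute diff_self)
      moreover have "b s = 0" if "s \<notin> C \<union> D" using that c(2) d(2) by (simp add: b_def)
      ultimately show "s \<in> (C \<union> D) - {e}" by blast
    qed
    ultimately show ?thesis by (meson subset_trans)
  qed
  have cP: "circuits (adjacency_matroid G) = minimal_sets ?P"
    by (simp add: adjacency_matroid_def)
  show ?thesis
    unfolding is_matroid_def cP
  proof (intro conjI)
    show "finite (ground (adjacency_matroid G))" using fin by (simp add: adjacency_matroid_def)
    show "minimal_sets ?P \<subseteq> Pow (ground (adjacency_matroid G))"
      by (auto simp: adjacency_matroid_def minimal_sets_def)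
    show "{} \<notin> minimal_sets ?P" by (simp add: minimal_sets_def)
    show "\<forall>C \<in> minimal_sets ?P. \<forall>D \<in> minimal_sets ?P. C \<subseteq> D \<longrightarrow> C = D"
      by (intro ballI impI) (rule minimal_sets_antichain)
    show "\<forall>C \<in> minimal_sets ?P. \<forall>D \<in> minimal_sets ?P. \<forall>e \<in> C \<inter> D.
            C \<noteq> D \<longrightarrow> (\<exists>B \<in> minimal_sets ?P. B \<subseteq> (C \<union> D) - {e})"
      by (intro ballI impI) (rule elim)
  qed
qed

end

theory Submission
  imports Defs
begin

text \<open>
  Over \<open>GF(2)\<close> a linear dependency of columns is the set of columns it uses, so the adjacency
  matroid is determined by the kernel of the adjacency matrix, seen as a family of vertex sets:
  the \<open>cycle_space\<close>. Its minimal nonempty members are the circuits, and contracting \<open>v\<close> removes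
  \<open>v\<close> from every member, that is, projects the kernel away from the coordinate \<open>v\<close>. All three
  parts therefore compare the projected kernel of \<open>G\<close> with the kernel of a smaller matrix
  (\<open>contract_eq_adjacency_matroid\<close>).

  If \<open>v\<close> is isolated and unlooped, row and column \<open>v\<close> vanish and there is nothing to do. If \<open>v\<close>
  is unlooped with a neighbor \<open>w\<close>, the equation of row \<open>w\<close> determines the coordinate \<open>v\<close> of a
  kernel vector from the others; eliminating that coordinate gives a system of equations on the
  remaining coordinates (\<open>projection_cycle_space_iff\<close>). Complementing at \<open>v\<close> adds to the matrix
  the rank one matrix \<open>n n\<^sup>T\<close>, where \<open>n\<close> is the neighborhood vector of \<open>v\<close>. When \<open>v\<close> and \<open>w\<close> are
  both unlooped, the rank one terms of the complementations at \<open>w\<close> and then \<open>v\<close> turn the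
  remaining rows into exactly the eliminated system: row \<open>w\<close> becomes the old row \<open>v\<close>, and every
  other row becomes its eliminated form up to multiples of the old row \<open>v\<close>.

  A looped neighbor reduces to this case. Complementing at an unlooped vertex \<open>v\<close> only adds row
  \<open>v\<close> to other rows, so it does not change the kernel, and it removes the loop at \<open>w\<close>.
\<close>

section \<open>Adjacency matrices under local complementation and vertex deletion\<close>

lemma bit_add_self [simp]: "(x::bit) + x = 0"
  by (cases x) auto

lemma adj_matrix_sym: "adj_matrix G x y = adj_matrix G y x"
  by (auto simp: adj_matrix_def adjacent_sym[of G x y])

text \<open>
  One rank one term covers both kinds of toggling: its diagonal entries toggle the loops at the
  neighbors of \<open>v\<close>, its other entries the adjacencies between them.
\<close>

lemma adj_matrix_local_complement:
  assumes "x \<in> verts G" "y \<in> verts G"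
  shows "adj_matrix (local_complement G v) x y =
           adj_matrix G x y + of_bool (adjacent G v x) * of_bool (adjacent G v y)"
  using assms
  by (auto simp: adj_matrix_def looped_local_complement adjacent_local_complement)

text \<open>
  The neighborhood vector of \<open>v\<close> is row \<open>v\<close> with its diagonal entry replaced by zero; it agrees
  with the row itself as soon as \<open>v\<close> is unlooped or the coordinate \<open>v\<close> is ignored.
\<close>

lemma of_bool_adjacent_eq_adj_matrix:
  assumes "x = v \<Longrightarrow> \<not> looped G v"
  shows "of_bool (adjacent G v x) = adj_matrix G v x"
  using assms by (auto simp: adj_matrix_def adjacent_def)

lemma adj_matrix_delete_vertex:
  assumes "x \<noteq> v" "y \<noteq> v"
  shows "adj_matrix (delete_vertex G v) x y = adj_matrix G x y"
proof -
  have "looped (delete_vertex G v) x \<longleftrightarrow> looped G x"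
    using assms unfolding looped_def delete_vertex_def by auto
  moreover have "adjacent (delete_vertex G v) x y \<longleftrightarrow> adjacent G x y"
    using assms unfolding adjacent_def delete_vertex_def by auto
  ultimately show ?thesis by (auto simp: adj_matrix_def)
qed

text \<open>\<open>row_sum G r C\<close> is entry \<open>r\<close> of the matrix applied to the indicator vector of \<open>C\<close>.\<close>

definition row_sum :: "('v, 'e) mgraph \<Rightarrow> 'v \<Rightarrow> 'v set \<Rightarrow> bit" where
  "row_sum G r C = (\<Sum>s \<in> C. adj_matrix G r s)"

lemma row_sum_insert:
  assumes "finite C" "v \<notin> C"
  shows "row_sum G r (insert v C) = adj_matrix G r v + row_sum G r C"
  using assms by (simp add: row_sum_def)

lemma row_sum_delete_vertex:
  assumes "r \<noteq> v" "v \<notin> C"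
  shows "row_sum (delete_vertex G v) r C = row_sum G r C"
  unfolding row_sum_def using assms
  by (intro sum.cong refl adj_matrix_delete_vertex) auto

lemma row_sum_local_complement:
  assumes "r \<in> verts G" "C \<subseteq> verts G"
    and "\<not> looped G v \<or> (r \<noteq> v \<and> v \<notin> C)"
  shows "row_sum (local_complement G v) r C =
           row_sum G r C + adj_matrix G v r * row_sum G v C"
proof -
  have "adj_matrix (local_complement G v) r s = adj_matrix G r s + adj_matrix G v r * adj_matrix G v s"
    if "s \<in> C" for s
  proof -
    have s: "s \<in> verts G" using that assms(2) by blast
    have "of_bool (adjacent G v r) = adj_matrix G v r"
      by (rule of_bool_adjacent_eq_adj_matrix) (use assms(3) in blast)
    moreover have "of_bool (adjacent G v s) = adj_matrix G v s"
      by (rule of_bool_adjacent_eq_adj_matrix) (use assms(3) that in blast)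
    ultimately show ?thesis
      using adj_matrix_local_complement[OF assms(1) s, of v] by simp
  qed
  then have "row_sum (local_complement G v) r C =
      (\<Sum>s \<in> C. adj_matrix G r s + adj_matrix G v r * adj_matrix G v s)"
    unfolding row_sum_def by (intro sum.cong refl)
  then show ?thesis
    by (simp only: row_sum_def sum.distrib sum_distrib_left)
qed


section \<open>The cycle space and its projections\<close>

definition cycle_space :: "('v, 'e) mgraph \<Rightarrow> 'v set set" where
  "cycle_space G = {C. C \<subseteq> verts G \<and> (\<forall>r \<in> verts G. row_sum G r C = 0)}"

text \<open>Only the minimal sets matter, so two families whose members contain each other's agree.\<close>

lemma minimal_sets_eqI:
  assumes PQ: "\<And>S. P S \<Longrightarrow> \<exists>T \<subseteq> S. Q T" and QP: "\<And>S. Q S \<Longrightarrow> \<exists>T \<subseteq> S. P T"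
  shows "minimal_sets P = minimal_sets Q"
proof -
  have "S \<in> minimal_sets Q"
    if S: "S \<in> minimal_sets P"
      and PQ: "\<And>S. P S \<Longrightarrow> \<exists>T \<subseteq> S. Q T" and QP: "\<And>S. Q S \<Longrightarrow> \<exists>T \<subseteq> S. P T"
    for S :: "'a set" and P Q
  proof -
    have PS: "P S" and min: "\<And>T. T \<subset> S \<Longrightarrow> \<not> P T" using S by (auto simp: minimal_sets_def)
    have nQ: "\<not> Q T" if "T \<subset> S" for T
      using QP[of T] min that by (meson subset_psubset_trans)
    obtain T where "T \<subseteq> S" "Q T" using PQ[OF PS] by blast
    with nQ have "Q S" by (metis psubsetI)
    with nQ show ?thesis by (simp add: minimal_sets_def)
  qed
  from this[OF _ PQ QP] this[OF _ QP PQ] show ?thesis by blast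
qed

text \<open>
  A coefficient in \<open>GF(2)\<close> is nonzero only if it is one, so the support of a dependency is a
  member of the cycle space, and conversely.
\<close>

lemma circuits_adjacency_matroid:
  assumes "fin_graph G"
  shows "circuits (adjacency_matroid G) = minimal_sets (\<lambda>S. S \<noteq> {} \<and> S \<in> cycle_space G)"
  unfolding adjacency_matroid_def matroid.simps
proof (rule minimal_sets_eqI)
  fix S assume S: "S \<noteq> {} \<and> S \<subseteq> verts G \<and> columns_dependent (adj_matrix G) (verts G) S"
  then obtain c where c: "\<exists>s \<in> S. c s \<noteq> 0"
    "\<forall>r \<in> verts G. (\<Sum>s \<in> S. c s * adj_matrix G r s) = 0"
    unfolding columns_dependent_def by blast
  have fin: "finite S" using S assms finite_subset by (auto simp: fin_graph_def)
  have "row_sum G r {s \<in> S. c s \<noteq> 0} = (\<Sum>s \<in> S. c s * adj_matrix G r s)" for r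
    unfolding row_sum_def using fin by (intro sum.mono_neutral_cong_left) auto
  then show "\<exists>T \<subseteq> S. T \<noteq> {} \<and> T \<in> cycle_space G"
    using c S by (intro exI[of _ "{s \<in> S. c s \<noteq> 0}"]) (auto simp: cycle_space_def)
next
  fix S assume S: "S \<noteq> {} \<and> S \<in> cycle_space G"
  then have "columns_dependent (adj_matrix G) (verts G) S"
    unfolding columns_dependent_def cycle_space_def row_sum_def
    by (intro exI[of _ "\<lambda>_. 1"]) (simp only: mult_1_left, auto)
  then show "\<exists>T \<subseteq> S. T \<noteq> {} \<and> T \<subseteq> verts G \<and> columns_dependent (adj_matrix G) (verts G) T"
    using S by (auto simp: cycle_space_def)
qed

lemma circuit_in_cycle:
  assumes "fin_graph G" "C \<in> cycle_space G" "C \<noteq> {}"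
  obtains D where "D \<in> circuits (adjacency_matroid G)" "D \<subseteq> C"
proof -
  have "finite C" using assms(1,2) finite_subset by (auto simp: fin_graph_def cycle_space_def)
  from minimal_sets_subset[OF this, of "\<lambda>S. S \<noteq> {} \<and> S \<in> cycle_space G"] show ?thesis
    using that assms circuits_adjacency_matroid[OF assms(1)] by auto
qed

text \<open>
  Circuits are cycles, so removing \<open>v\<close> from a circuit gives a projected cycle. Conversely, a
  nonempty projected cycle comes from a cycle, which contains a circuit. The only danger is that
  this circuit is \<open>{v}\<close>, which leaves nothing after projection; but then \<open>{v}\<close> is itself a cycle
  and may be subtracted first, so that a circuit avoiding \<open>v\<close> is found.
\<close>

lemma circuits_contract_adjacency_matroid:
  assumes G: "fin_graph G"
  shows "circuits (contract (adjacency_matroid G) v) =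
           minimal_sets (\<lambda>S. S \<noteq> {} \<and> S \<in> (\<lambda>C. C - {v}) ` cycle_space G)"
  unfolding contract_def matroid.simps
proof (rule minimal_sets_eqI)
  let ?M = "adjacency_matroid G"
  have circ: "C \<noteq> {} \<and> C \<in> cycle_space G" if "C \<in> circuits ?M" for C
    using that circuits_adjacency_matroid[OF G] by (auto simp: minimal_sets_def)
  show "\<exists>T \<subseteq> S. T \<noteq> {} \<and> T \<in> (\<lambda>C. C - {v}) ` cycle_space G"
    if S: "S \<noteq> {} \<and> S \<subseteq> ground ?M - {v} \<and>
        (\<exists>C \<in> circuits ?M. C \<noteq> {v} \<and> C \<subseteq> S \<union> {v})" for S
  proof -
    obtain C where C: "C \<in> circuits ?M" "C \<noteq> {v}" "C \<subseteq> S \<union> {v}" using S by blast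
    have "C - {v} \<noteq> {}" "C - {v} \<subseteq> S" using C circ[OF C(1)] by blast+
    then show ?thesis using circ[OF C(1)] by blast
  qed
  show "\<exists>T \<subseteq> S. T \<noteq> {} \<and> T \<subseteq> ground ?M - {v} \<and>
        (\<exists>C \<in> circuits ?M. C \<noteq> {v} \<and> C \<subseteq> T \<union> {v})"
    if S: "S \<noteq> {} \<and> S \<in> (\<lambda>C. C - {v}) ` cycle_space G" for S
  proof -
    obtain C where C: "C \<in> cycle_space G" "S = C - {v}" using S by blast
    have fin: "finite S"
      using C G finite_subset by (auto simp: cycle_space_def fin_graph_def)
    have SV: "S \<subseteq> ground ?M - {v}" using C by (auto simp: cycle_space_def adjacency_matroid_def)
    have "\<exists>D \<in> circuits ?M. D \<noteq> {v} \<and> D \<subseteq> S \<union> {v}"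
    proof (cases "{v} \<in> cycle_space G")
      case True
      have "row_sum G r S = 0" if "r \<in> verts G" for r
      proof (cases "v \<in> C")
        case vC: True
        have "row_sum G r C = adj_matrix G r v + row_sum G r S"
          using row_sum_insert[OF fin, of v G r] C(2) vC by (simp add: insert_absorb)
        moreover have "adj_matrix G r v = 0" "row_sum G r C = 0"
          using True C(1) that by (auto simp: cycle_space_def row_sum_def)
        ultimately show ?thesis by simp
      next
        case False
        then show ?thesis using C that by (auto simp: cycle_space_def)
      qed
      then have "S \<in> cycle_space G" using C by (auto simp: cycle_space_def)
      from circuit_in_cycle[OF G this] S obtain D where "D \<in> circuits ?M" "D \<subseteq> S" by blast
      then show ?thesis using C(2) by blast
    next
      case False
      have "C \<noteq> {}" using S C by blast
      from circuit_in_cycle[OF G C(1) this] obtain D where D: "D \<in> circuits ?M" "D \<subseteq> C" .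
      moreover have "D \<noteq> {v}" using circ[OF D(1)] False by blast
      ultimately show ?thesis using C(2) by blast
    qed
    then show ?thesis using S SV by blast
  qed
qed

lemma contract_eq_adjacency_matroid:
  assumes "fin_graph G" "fin_graph H" "verts H = verts G - {v}"
    and "(\<lambda>C. C - {v}) ` cycle_space G = cycle_space H"
  shows "contract (adjacency_matroid G) v = adjacency_matroid H"
proof -
  have "circuits (contract (adjacency_matroid G) v) = circuits (adjacency_matroid H)"
    using circuits_contract_adjacency_matroid[OF assms(1), of v]
      circuits_adjacency_matroid[OF assms(2)] assms(4) by simp
  moreover have "ground (contract (adjacency_matroid G) v) = ground (adjacency_matroid H)"
    using assms(3) by (simp add: contract_def adjacency_matroid_def)
  ultimately show ?thesis by (intro matroid.equality) simp_all
qed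

lemma projection_cycle_space_cases:
  assumes "v \<in> verts G"
  shows "C \<in> (\<lambda>C. C - {v}) ` cycle_space G \<longleftrightarrow>
           v \<notin> C \<and> (C \<in> cycle_space G \<or> insert v C \<in> cycle_space G)"
proof
  assume "C \<in> (\<lambda>C. C - {v}) ` cycle_space G"
  then obtain D where "D \<in> cycle_space G" "C = D - {v}" by blast
  then show "v \<notin> C \<and> (C \<in> cycle_space G \<or> insert v C \<in> cycle_space G)"
    by (cases "v \<in> D") (auto simp: insert_absorb)
next
  assume "v \<notin> C \<and> (C \<in> cycle_space G \<or> insert v C \<in> cycle_space G)"
  moreover from this have "C = C - {v}" "C = insert v C - {v}" by blast+
  ultimately show "C \<in> (\<lambda>C. C - {v}) ` cycle_space G" by blast
qed

text \<open>
  Elimination of the coordinate \<open>v\<close>: row \<open>w\<close> has entry one in column \<open>v\<close>, so it forces that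
  coordinate to be \<open>row_sum G w C\<close>. Substituting this value into the other rows leaves the stated
  equations; row \<open>v\<close> has diagonal entry zero and is kept unchanged.
\<close>

lemma projection_cycle_space_iff:
  assumes G: "fin_graph G" and v: "v \<in> verts G" "\<not> looped G v" and w: "w \<in> verts G" "adjacent G v w"
  shows "C \<in> (\<lambda>C. C - {v}) ` cycle_space G \<longleftrightarrow>
           C \<subseteq> verts G - {v} \<and> row_sum G v C = 0 \<and>
           (\<forall>r \<in> verts G - {v}. row_sum G r C + adj_matrix G v r * row_sum G w C = 0)"
    (is "_ \<longleftrightarrow> ?R")
proof (cases "C \<subseteq> verts G - {v}")
  case False
  then show ?thesis using projection_cycle_space_cases[OF v(1)] by (auto simp: cycle_space_def)
next
  case True
  have fin: "finite C" using True G finite_subset by (fastforce simp: fin_graph_def)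
  have vC: "v \<notin> C" using True by blast
  have vv: "adj_matrix G v v = 0" using v by (simp add: adj_matrix_def)
  have vw: "adj_matrix G v w = 1" using w by (auto simp: adj_matrix_def adjacent_def)
  have ins: "row_sum G r (insert v C) = row_sum G r C + adj_matrix G v r" for r
    using row_sum_insert[OF fin vC, of G r] adj_matrix_sym[of G r v] by (simp only: add.commute)
  have wv: "w \<in> verts G - {v}" using w by (auto simp: adjacent_def)
  have rows: "(\<forall>r \<in> verts G. f r = 0) \<longleftrightarrow> f v = 0 \<and> (\<forall>r \<in> verts G - {v}. f r = 0)"
    for f :: "'a \<Rightarrow> bit"
    using v(1) by blast
  have C0: "C \<in> cycle_space G \<longleftrightarrow> row_sum G v C = 0 \<and> (\<forall>r \<in> verts G - {v}. row_sum G r C = 0)"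
    using True rows[of "\<lambda>r. row_sum G r C"] by (auto simp: cycle_space_def)
  have C1: "insert v C \<in> cycle_space G \<longleftrightarrow>
      row_sum G v C = 0 \<and> (\<forall>r \<in> verts G - {v}. row_sum G r C + adj_matrix G v r = 0)"
    using True v(1) rows[of "\<lambda>r. row_sum G r (insert v C)"] vv by (auto simp: cycle_space_def ins)
  show ?thesis
  proof (cases "row_sum G w C")
    case zero
    then have "insert v C \<notin> cycle_space G" using C1 wv vw by force
    then show ?thesis
      using projection_cycle_space_cases[OF v(1), of C] C0 True vC zero by simp
  next
    case one
    then have "C \<notin> cycle_space G" using C0 wv by force
    then show ?thesis
      using projection_cycle_space_cases[OF v(1), of C] C1 True vC one by simp
  qed
qed


section \<open>Contraction of an unlooped vertex\<close>

lemma contract_isolated_vertex: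
  assumes G: "fin_graph G" and v: "v \<in> verts G" and iso: "isolated G v"
  shows "contract (adjacency_matroid G) v = adjacency_matroid (delete_vertex G v)"
proof (rule contract_eq_adjacency_matroid[OF G fin_graph_delete_vertex[OF G]])
  show VD: "verts (delete_vertex G v) = verts G - {v}" by (simp add: delete_vertex_def)
  have zero: "adj_matrix G v r = 0" "adj_matrix G r v = 0" for r
  proof -
    show "adj_matrix G v r = 0"
      using iso by (auto simp: isolated_def adj_matrix_def looped_def adjacent_def)
    then show "adj_matrix G r v = 0" by (simp add: adj_matrix_sym)
  qed
  have row_v: "row_sum G v C = 0" for C by (simp add: row_sum_def zero)
  have "C \<in> (\<lambda>C. C - {v}) ` cycle_space G \<longleftrightarrow>
      C \<subseteq> verts G - {v} \<and> (\<forall>r \<in> verts G - {v}. row_sum G r C = 0)" for C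
  proof (cases "C \<subseteq> verts G - {v}")
    case True
    then have C: "v \<notin> C" "C \<subseteq> verts G" "insert v C \<subseteq> verts G" using v by auto
    have fin: "finite C" using finite_subset[OF C(2)] G by (simp add: fin_graph_def)
    have ins: "row_sum G r (insert v C) = row_sum G r C" for r
      using row_sum_insert[OF fin C(1), of G r] by (simp only: zero add_0_left)
    have "insert v C \<in> cycle_space G \<longleftrightarrow> C \<in> cycle_space G"
      unfolding cycle_space_def mem_Collect_eq ins using C(2,3) by (simp only: simp_thms)
    moreover have "C \<in> cycle_space G \<longleftrightarrow> (\<forall>r \<in> verts G - {v}. row_sum G r C = 0)"
    proof -
      have "(\<forall>r \<in> verts G. row_sum G r C = 0) \<longleftrightarrow> (\<forall>r \<in> verts G - {v}. row_sum G r C = 0)"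
        using row_v[of C] by (metis DiffE DiffI singletonD)
      then show ?thesis unfolding cycle_space_def mem_Collect_eq using C(2) by (simp only: simp_thms)
    qed
    ultimately show ?thesis
      using projection_cycle_space_cases[OF v, of C] True C(1) by blast
  next
    case False
    then show ?thesis by (auto simp: cycle_space_def)
  qed
  moreover have "C \<in> cycle_space (delete_vertex G v) \<longleftrightarrow>
      C \<subseteq> verts G - {v} \<and> (\<forall>r \<in> verts G - {v}. row_sum G r C = 0)" for C
  proof -
    have eq: "row_sum (delete_vertex G v) r C = row_sum G r C"
      if "C \<subseteq> verts G - {v}" "r \<in> verts G - {v}" for r
      using that by (intro row_sum_delete_vertex) auto
    show ?thesis unfolding cycle_space_def mem_Collect_eq VD
      by (intro conj_cong ball_cong refl) (simp only: eq)
  qed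
  ultimately show "(\<lambda>C. C - {v}) ` cycle_space G = cycle_space (delete_vertex G v)"
    by (intro set_eqI) (simp only:)
qed

lemma contract_unlooped_neighbor:
  assumes G: "fin_graph G" and v: "v \<in> verts G" "\<not> looped G v"
    and w: "w \<in> verts G" "adjacent G v w" "\<not> looped G w"
  shows "contract (adjacency_matroid G) v =
    adjacency_matroid (delete_vertex (local_complement (local_complement G w) v) v)"
proof (rule contract_eq_adjacency_matroid)
  let ?G1 = "local_complement G w"
  let ?H = "delete_vertex (local_complement ?G1 v) v"
  show "fin_graph G" by (rule G)
  show "fin_graph ?H"
    by (intro fin_graph_delete_vertex fin_graph_local_complement G)
  show VH: "verts ?H = verts G - {v}" by (simp add: delete_vertex_def)
  have vw: "adj_matrix G w v = 1"
    using w adjacent_sym[of G v w] by (auto simp: adj_matrix_def adjacent_def)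
  have wv: "adj_matrix G v w = 1" using vw by (simp add: adj_matrix_sym)
  have ww: "adj_matrix G w w = 0" using w by (simp add: adj_matrix_def)
  have wV: "w \<in> verts G - {v}" using w by (auto simp: adjacent_def)
  have row1: "row_sum ?G1 r C = row_sum G r C + adj_matrix G w r * row_sum G w C"
    if "r \<in> verts G" "C \<subseteq> verts G" for r C
    using that w by (intro row_sum_local_complement) auto
  \<comment> \<open>Complementing at \<open>w\<close> adds row \<open>w\<close> to row \<open>v\<close>, because \<open>v\<close> is a neighbor of \<open>w\<close>.\<close>
  have adj1: "adj_matrix ?G1 v r = adj_matrix G v r + adj_matrix G w r" if "r \<in> verts G" for r
    using row1[OF v(1), of "{r}"] that
    by (simp only: row_sum_def vw mult_1_left sum.insert sum.empty finite.emptyI empty_iff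
      insert_subset empty_subsetI simp_thms add_0_right)
  have row2: "row_sum ?H r C = row_sum G r C + adj_matrix G w r * row_sum G w C +
      (adj_matrix G v r + adj_matrix G w r) * (row_sum G v C + row_sum G w C)"
    if "r \<in> verts G - {v}" "C \<subseteq> verts G - {v}" for r C
  proof -
    have CV: "C \<subseteq> verts G" using that by blast
    have "row_sum ?H r C = row_sum (local_complement ?G1 v) r C"
      using that by (intro row_sum_delete_vertex) auto
    also have "\<dots> = row_sum ?G1 r C + adj_matrix ?G1 v r * row_sum ?G1 v C"
      using that by (intro row_sum_local_complement) auto
    also have "row_sum ?G1 v C = row_sum G v C + row_sum G w C"
      using row1[OF v(1) CV] by (simp only: vw mult_1_left)
    finally show ?thesis using row1[of r C] adj1[of r] that CV by simp
  qed
  have row_w: "row_sum ?H w C = row_sum G v C" if "C \<subseteq> verts G - {v}" for C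
    using row2[OF wV that] by (cases "row_sum G w C") (simp_all add: wv ww)
  have row_r: "row_sum ?H r C = row_sum G r C + adj_matrix G v r * row_sum G w C"
    if "r \<in> verts G - {v}" "C \<subseteq> verts G - {v}" "row_sum G v C = 0" for r C
    using row2[OF that(1,2)] that(3)
    by (cases "adj_matrix G w r"; cases "row_sum G w C"; cases "adj_matrix G v r";
        cases "row_sum G r C"; simp)
  have "C \<in> cycle_space ?H \<longleftrightarrow> C \<in> (\<lambda>C. C - {v}) ` cycle_space G" for C
  proof (cases "C \<subseteq> verts G - {v} \<and> row_sum G v C = 0")
    case True
    then show ?thesis
      unfolding projection_cycle_space_iff[OF G v w(1,2)] using row_r[of _ C]
      by (simp add: cycle_space_def VH)
  next
    case False
    then have "C \<notin> cycle_space ?H" using row_w[of C] wV by (auto simp: cycle_space_def VH)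
    then show ?thesis unfolding projection_cycle_space_iff[OF G v w(1,2)] using False by blast
  qed
  then show "(\<lambda>C. C - {v}) ` cycle_space G = cycle_space ?H"
    by (intro set_eqI) (simp only:)
qed

text \<open>
  Each row \<open>r\<close> changes by a multiple of row \<open>v\<close>, and row \<open>v\<close> itself is fixed because its diagonal
  entry is zero.
\<close>

lemma adjacency_matroid_local_complement:
  assumes G: "fin_graph G" and v: "v \<in> verts G" "\<not> looped G v"
  shows "adjacency_matroid (local_complement G v) = adjacency_matroid G"
proof -
  have row: "row_sum (local_complement G v) r C =
      row_sum G r C + adj_matrix G v r * row_sum G v C" if "r \<in> verts G" "C \<subseteq> verts G" for r C
    using that v by (intro row_sum_local_complement) auto
  have vv: "adj_matrix G v v = 0" using v by (simp add: adj_matrix_def)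
  have "C \<in> cycle_space (local_complement G v) \<longleftrightarrow> C \<in> cycle_space G" for C
  proof (cases "C \<subseteq> verts G \<and> row_sum G v C = 0")
    case True
    then show ?thesis using row[of _ C] by (simp add: cycle_space_def)
  next
    case False
    then show ?thesis using row[OF v(1), of C] v(1) vv by (auto simp: cycle_space_def)
  qed
  then have "cycle_space (local_complement G v) = cycle_space G" by blast
  then have "circuits (adjacency_matroid (local_complement G v)) = circuits (adjacency_matroid G)"
    using circuits_adjacency_matroid[OF G]
      circuits_adjacency_matroid[OF fin_graph_local_complement[OF G], of v] by simp
  then show ?thesis by (intro matroid.equality) (simp_all add: adjacency_matroid_def)
qed

theorem theorem16:
  fixes G :: "('v, 'e) mgraph" and v :: 'v
  assumes "fin_graph G" and "v \<in> verts G" and "\<not> looped G v"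
  shows "(isolated G v \<longrightarrow>
            contract (adjacency_matroid G) v = adjacency_matroid (delete_vertex G v)) \<and>
         (\<forall>w. adjacent G v w \<and> \<not> looped G w \<longrightarrow>
            contract (adjacency_matroid G) v =
            adjacency_matroid (delete_vertex (local_complement (local_complement G w) v) v)) \<and>
         (\<forall>w. adjacent G v w \<and> looped G w \<longrightarrow>
            contract (adjacency_matroid G) v =
            adjacency_matroid (delete_vertex
              (local_complement (local_complement (local_complement G v) w) v) v))"
proof (intro conjI allI impI)
  have wV: "w \<in> verts G" if "adjacent G v w" for w
    using that assms(1) by (auto simp: adjacent_def fin_graph_def)
  show "contract (adjacency_matroid G) v = adjacency_matroid (delete_vertex G v)"
    if "isolated G v"
    by (rule contract_isolated_vertex[OF assms(1,2) that])
  show "contract (adjacency_matroid G) v =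
      adjacency_matroid (delete_vertex (local_complement (local_complement G w) v) v)"
    if "adjacent G v w \<and> \<not> looped G w" for w
    using contract_unlooped_neighbor[OF assms] wV that by blast
  show "contract (adjacency_matroid G) v =
      adjacency_matroid (delete_vertex
        (local_complement (local_complement (local_complement G v) w) v) v)"
    if w: "adjacent G v w \<and> looped G w" for w
  proof -
    let ?G1 = "local_complement G v"
    have V: "w \<in> verts G" "v \<noteq> w" using wV w by (auto simp: adjacent_def)
    \<comment> \<open>The loop at \<open>w\<close> is toggled away; \<open>v\<close> stays unlooped and keeps its neighbors.\<close>
    have "\<not> looped ?G1 v" "\<not> looped ?G1 w" "adjacent ?G1 v w"
      using assms w V
      by (auto simp: looped_local_complement adjacent_local_complement)
        (auto simp: adjacent_def)
    then have "contract (adjacency_matroid ?G1) v =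
        adjacency_matroid (delete_vertex (local_complement (local_complement ?G1 w) v) v)"
      using assms V by (intro contract_unlooped_neighbor fin_graph_local_complement) auto
    then show ?thesis using adjacency_matroid_local_complement[OF assms] by simp
  qed
qed

end
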